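(* There exists a left cancellative monoid $S$ for which the groupoids $\mathcal G_P(S)$ and $\mathcal G(S)$ do not coincide, i.e. such that the quotient map $\mathcal G_P(S)\to\mathcal G(S)$ is not injective.
   Context: $S$ is a left cancellative monoid ($st=st'\Rightarrow t=t'$). Identify $s\in S$ with the injection $S\to S$, $t\mapsto st$, and let $s^{-1}$ be the inverse partial bijection $sS\to S$. $I_\ell(S)$ is the inverse semigroup of partial bijections of $S$ generated by the left translations; its elements are the compositions $s_{2n}^{-1}s_{2n-1}\cdots s_2^{-1}s_1$. $\mathcal J(S)=\{\operatorname{dom} g: g\in I_\ell(S)\}$ is the set of constructible right ideals, a semigroup under intersection. $\bar{\mathcal J}(S)$ is the collection obtained from $\mathcal J(S)$ by adding all sets $X\setminus\bigcup_{i=1}^mX_i$ with $X,X_i\in\mathcal J(S)$. Characters are nonzero semigroup homomorphisms $\chi:\mathcal J(S)\to\{0,1\}$, with the topology of pointwise convergence. $\chi_s(X)=1$ iff $s\in X$. $\Omega(S)=\overline{\{\chi_s:s\in S\}}$. Each $\chi\in\Omega(S)$ extends to $\bar{\mathcal J}(S)$ by $\chi(X\setminus\bigcup_iX_i)=1$ iff $\chi(X)=1$ and $\chi(X_i)=0$ for all $i$. $\mathcal G_P(S)$ is the set of classes $[g,\chi]$ of pairs $(g,\chi)\in I_\ell(S)\times\Omega(S)$ with $\chi(\operatorname{dom}g)=1$, where $(g_1,\chi_1)\sim(g_2,\chi_2)$ iff $\chi_1=\chi_2$ and $g_1|_A=g_2|_A$ for some $A\in\mathcal J(S)$ with $A\subseteq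 \operatorname{dom}g_1\cap\operatorname{dom}g_2$ and $\chi_1(A)=1$; it is a groupoid with product $[g,\chi][h,\psi]=[gh,\psi]$ if $\chi=\psi(h^{-1}(\cdot))$. $\mathcal G(S)=\mathcal G_P(S)/\sim_2$ is the quotient groupoid, where $[g,\chi]\sim_2[h,\chi]$ iff there is $X\in\bar{\mathcal J}(S)$, $X\subseteq\operatorname{dom}g\cap\operatorname{dom}h$, with $\chi(X)=1$ and $g|_X=h|_X$. *)

theory Defs
  imports "HOL-Algebra.Group" "HOL-Analysis.Function_Topology"
begin

locale left_cancellative_monoid = monoid S for S (structure) +
  assumes left_cancel:
    "\<lbrakk>s \<in> carrier S; t \<in> carrier S; t' \<in> carrier S; s \<otimes> t = s \<otimes> t'\<rbrakk> \<Longrightarrow> t = t'"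


section \<open>Partial bijections generated by the left translations\<close>

text \<open>Partial bijections of the monoid are maps \<open>'a \<rightharpoonup> 'a\<close>, composed by \<open>\<circ>\<^sub>m\<close>.\<close>

definition left_translation :: "('a, 'b) monoid_scheme \<Rightarrow> 'a \<Rightarrow> ('a \<rightharpoonup> 'a)" where
  "left_translation S s = (\<lambda>t. if t \<in> carrier S then Some (s \<otimes>\<^bsub>S\<^esub> t) else None)"

definition pinv :: "('a \<rightharpoonup> 'a) \<Rightarrow> ('a \<rightharpoonup> 'a)" where
  "pinv f = (\<lambda>y. if \<exists>x. f x = Some y then Some (THE x. f x = Some y) else None)"

definition preimage :: "('a \<rightharpoonup> 'a) \<Rightarrow> 'a set \<Rightarrow> 'a set" where
  "preimage f X = {t. \<exists>u\<in>X. f t = Some u}"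

inductive_set left_inverse_hull :: "('a, 'b) monoid_scheme \<Rightarrow> ('a \<rightharpoonup> 'a) set"
  for S :: "('a, 'b) monoid_scheme" where
  translation: "s \<in> carrier S \<Longrightarrow> left_translation S s \<in> left_inverse_hull S"
| inverse: "g \<in> left_inverse_hull S \<Longrightarrow> pinv g \<in> left_inverse_hull S"
| compose: "g \<in> left_inverse_hull S \<Longrightarrow> h \<in> left_inverse_hull S \<Longrightarrow> g \<circ>\<^sub>m h \<in> left_inverse_hull S"

definition constructible :: "('a, 'b) monoid_scheme \<Rightarrow> 'a set set" where
  "constructible S = dom ` left_inverse_hull S"

definition constructible_bar :: "('a, 'b) monoid_scheme \<Rightarrow> 'a set set" where
  "constructible_bar S =
     constructible S \<union> {X - \<Union>F | X F. X \<in> constructible S \<and> finite F \<and> F \<subseteq> constructible S}"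


section \<open>Characters\<close>

text \<open>A character is a function on the constructible ideals only; as usual in
  \<^theory>\<open>HOL-Library.FuncSet\<close>, it is \<open>undefined\<close> elsewhere.\<close>

definition characters :: "('a, 'b) monoid_scheme \<Rightarrow> ('a set \<Rightarrow> nat) set" where
  "characters S = {\<chi> \<in> constructible S \<rightarrow>\<^sub>E {0, 1}.
     (\<forall>X\<in>constructible S. \<forall>Y\<in>constructible S. \<chi> (X \<inter> Y) = \<chi> X * \<chi> Y) \<and>
     (\<exists>X\<in>constructible S. \<chi> X \<noteq> 0)}"

definition character_topology :: "('a, 'b) monoid_scheme \<Rightarrow> ('a set \<Rightarrow> nat) topology" where
  "character_topology S =
     subtopology (product_topology (\<lambda>X. discrete_topology {0, 1}) (constructible S)) (characters S)"

definition principal_character :: "('a, 'b) monoid_scheme \<Rightarrow> 'a \<Rightarrow> 'a set \<Rightarrow> nat" where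
  "principal_character S s = (\<lambda>X\<in>constructible S. if s \<in> X then 1 else 0)"

definition Omega :: "('a, 'b) monoid_scheme \<Rightarrow> ('a set \<Rightarrow> nat) set" where
  "Omega S = character_topology S closure_of (principal_character S ` carrier S)"

text \<open>For \<open>\<chi> \<in> Omega S\<close> the choice of the presentation \<open>Y = X - \<Union>F\<close> does not matter,
  see \<open>char_ext_diff\<close> below.\<close>

definition char_ext :: "('a, 'b) monoid_scheme \<Rightarrow> ('a set \<Rightarrow> nat) \<Rightarrow> 'a set \<Rightarrow> nat" where
  "char_ext S \<chi> = (\<lambda>Y\<in>constructible_bar S.
     if \<exists>X F. X \<in> constructible S \<and> finite F \<and> F \<subseteq> constructible S \<and> Y = X - \<Union>F \<and>
              \<chi> X = 1 \<and> (\<forall>Z\<in>F. \<chi> Z = 0)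
     then 1 else 0)"


section \<open>The two groupoids\<close>

text \<open>A groupoid is given by its set of arrows and its partially defined product; the products
  of classes below are well-defined by \<open>is_germ_product_unique\<close> and \<open>is_quot_product_unique\<close>.\<close>

record 'a groupoid = "'a partial_object" +
  arrow_product :: "'a \<Rightarrow> 'a \<Rightarrow> 'a option"

type_synonym 'a germ_pair = "('a \<rightharpoonup> 'a) \<times> ('a set \<Rightarrow> nat)"

definition germ_pairs :: "('a, 'b) monoid_scheme \<Rightarrow> 'a germ_pair set" where
  "germ_pairs S = {(g, \<chi>). g \<in> left_inverse_hull S \<and> \<chi> \<in> Omega S \<and> \<chi> (dom g) = 1}"

definition germ_rel :: "('a, 'b) monoid_scheme \<Rightarrow> ('a germ_pair \<times> 'a germ_pair) set" where
  "germ_rel S = {((g, \<chi>), (h, \<psi>)). (g, \<chi>) \<in> germ_pairs S \<and> (h, \<psi>) \<in> germ_pairs S \<and> \<chi> = \<psi> \<and>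
     (\<exists>A\<in>constructible S. A \<subseteq> dom g \<inter> dom h \<and> \<chi> A = 1 \<and> g |` A = h |` A)}"

definition germ :: "('a, 'b) monoid_scheme \<Rightarrow> ('a \<rightharpoonup> 'a) \<Rightarrow> ('a set \<Rightarrow> nat) \<Rightarrow> 'a germ_pair set" where
  "germ S g \<chi> = germ_rel S `` {(g, \<chi>)}"

definition translate_char ::
    "('a, 'b) monoid_scheme \<Rightarrow> ('a \<rightharpoonup> 'a) \<Rightarrow> ('a set \<Rightarrow> nat) \<Rightarrow> ('a set \<Rightarrow> nat)" where
  "translate_char S h \<psi> = (\<lambda>X\<in>constructible S. \<psi> (preimage h X))"

definition is_germ_product ::
    "('a, 'b) monoid_scheme \<Rightarrow> 'a germ_pair set \<Rightarrow> 'a germ_pair set \<Rightarrow> 'a germ_pair set \<Rightarrow> bool" where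
  "is_germ_product S C D E \<longleftrightarrow> (\<exists>g \<chi> h \<psi>. (g, \<chi>) \<in> germ_pairs S \<and> (h, \<psi>) \<in> germ_pairs S \<and>
     C = germ S g \<chi> \<and> D = germ S h \<psi> \<and> \<chi> = translate_char S h \<psi> \<and> E = germ S (g \<circ>\<^sub>m h) \<psi>)"

definition groupoid_GP :: "('a, 'b) monoid_scheme \<Rightarrow> 'a germ_pair set groupoid" where
  "groupoid_GP S = \<lparr>carrier = germ_pairs S // germ_rel S,
     arrow_product = (\<lambda>C D. if \<exists>E. is_germ_product S C D E
                      then Some (THE E. is_germ_product S C D E) else None)\<rparr>"

definition sim2 :: "('a, 'b) monoid_scheme \<Rightarrow> ('a germ_pair set \<times> 'a germ_pair set) set" where
  "sim2 S = {(germ S g \<chi>, germ S h \<chi>) | g h \<chi>. (g, \<chi>) \<in> germ_pairs S \<and> (h, \<chi>) \<in> germ_pairs S \<and>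
     (\<exists>X\<in>constructible_bar S. X \<subseteq> dom g \<inter> dom h \<and> char_ext S \<chi> X = 1 \<and> g |` X = h |` X)}"

definition germ_quotient ::
    "('a, 'b) monoid_scheme \<Rightarrow> 'a germ_pair set \<Rightarrow> 'a germ_pair set set" where
  "germ_quotient S C = sim2 S `` {C}"

definition is_quot_product :: "('a, 'b) monoid_scheme \<Rightarrow>
    'a germ_pair set set \<Rightarrow> 'a germ_pair set set \<Rightarrow> 'a germ_pair set set \<Rightarrow> bool" where
  "is_quot_product S P Q R \<longleftrightarrow> (\<exists>C D E. C \<in> carrier (groupoid_GP S) \<and> D \<in> carrier (groupoid_GP S) \<and>
     P = germ_quotient S C \<and> Q = germ_quotient S D \<and> arrow_product (groupoid_GP S) C D = Some E \<and>
     R = germ_quotient S E)"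

definition groupoid_G :: "('a, 'b) monoid_scheme \<Rightarrow> 'a germ_pair set set groupoid" where
  "groupoid_G S = \<lparr>carrier = carrier (groupoid_GP S) // sim2 S,
     arrow_product = (\<lambda>P Q. if \<exists>R. is_quot_product S P Q R
                      then Some (THE R. is_quot_product S P Q R) else None)\<rparr>"


section \<open>Well-definedness\<close>

lemma in_preimage [simp]: "t \<in> preimage f X \<longleftrightarrow> (\<exists>u\<in>X. f t = Some u)"
  by (simp add: preimage_def)

lemma dom_map_comp: "dom (g \<circ>\<^sub>m h) = preimage h (dom g)"
  by (auto simp: map_comp_def split: option.splits)

lemma pinv_eq_Some:
  assumes "inj_on f (dom f)"
  shows "pinv f y = Some x \<longleftrightarrow> f x = Some y"
proof -
  have u: "x1 = x2" if "f x1 = Some y" "f x2 = Some y" for x1 x2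
    using assms that by (metis domI inj_on_def)
  show ?thesis
  proof (cases "\<exists>x. f x = Some y")
    case True
    then obtain z where z: "f z = Some y" by blast
    have "(THE x. f x = Some y) = z" using z u by blast
    then show ?thesis using z u by (auto simp: pinv_def)
  qed (auto simp: pinv_def)
qed

lemma restrict_eq_iff: "A \<subseteq> dom g \<inter> dom h \<Longrightarrow> g |` A = h |` A \<longleftrightarrow> (\<forall>t\<in>A. g t = h t)"
  by (auto simp: restrict_map_def fun_eq_iff)

context left_cancellative_monoid
begin

lemma left_inverse_hull_partial_bij:
  assumes "g \<in> left_inverse_hull S"
  shows "inj_on g (dom g)" "dom g \<subseteq> carrier S" "ran g \<subseteq> carrier S"
proof -
  have "(\<forall>x x' y. g x = Some y \<longrightarrow> g x' = Some y \<longrightarrow> x = x') \<and>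
      (\<forall>x y. g x = Some y \<longrightarrow> x \<in> carrier S \<and> y \<in> carrier S)"
    using assms
  proof induction
    case (translation s)
    then show ?case using left_cancel[of s] by (auto simp: left_translation_def split: if_splits)
  next
    case (inverse g)
    then have "inj_on g (dom g)" unfolding inj_on_def by (metis domD)
    then have "\<And>x y. pinv g y = Some x \<longleftrightarrow> g x = Some y" by (rule pinv_eq_Some)
    then show ?case using inverse by simp
  next
    case (compose g h)
    then show ?case unfolding map_comp_Some_iff by metis
  qed
  then have u: "\<And>x x' y. g x = Some y \<Longrightarrow> g x' = Some y \<Longrightarrow> x = x'"
    and c: "\<And>x y. g x = Some y \<Longrightarrow> x \<in> carrier S \<and> y \<in> carrier S" by blast+
  show "inj_on g (dom g)"
  proof (rule inj_onI)
    fix x x' assume a: "x \<in> dom g" "g x = g x'"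
    then obtain y where y: "g x = Some y" by blast
    moreover have "g x' = Some y" using a(2) y by simp
    ultimately show "x = x'" by (rule u)
  qed
  show "dom g \<subseteq> carrier S" "ran g \<subseteq> carrier S" using c by (auto simp: dom_def ran_def)
qed

lemma left_inverse_hull_inj:
  assumes "g \<in> left_inverse_hull S" "g t = Some y" "g u = Some y"
  shows "t = u"
proof (rule inj_onD[OF left_inverse_hull_partial_bij(1)[OF assms(1)]])
  show "g t = g u" using assms by simp
qed (use assms in \<open>auto intro: domI\<close>)

lemma dom_in_constructible [intro]: "g \<in> left_inverse_hull S \<Longrightarrow> dom g \<in> constructible S"
  by (simp add: constructible_def)

lemma constructible_preimage:
  assumes "h \<in> left_inverse_hull S" "X \<in> constructible S"
  shows "preimage h X \<in> constructible S"
proof -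
  obtain g where "g \<in> left_inverse_hull S" "X = dom g" using assms by (auto simp: constructible_def)
  then show ?thesis using dom_in_constructible[of "g \<circ>\<^sub>m h"] assms
    by (simp add: dom_map_comp left_inverse_hull.compose)
qed

lemma constructible_Int:
  assumes "X \<in> constructible S" "Y \<in> constructible S"
  shows "X \<inter> Y \<in> constructible S"
proof -
  obtain g where g: "g \<in> left_inverse_hull S" "Y = dom g" using assms by (auto simp: constructible_def)
  have h: "pinv g \<circ>\<^sub>m g \<in> left_inverse_hull S"
    using g by (intro left_inverse_hull.intros)
  note inj = left_inverse_hull_partial_bij(1)[OF g(1)]
  have "(pinv g \<circ>\<^sub>m g) t = Some u \<longleftrightarrow> t = u \<and> t \<in> Y" for t u
    unfolding map_comp_Some_iff g(2) pinv_eq_Some[OF inj] using left_inverse_hull_inj[OF g(1), of t _ u] by blast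
  then have "preimage (pinv g \<circ>\<^sub>m g) X = X \<inter> Y" by auto
  then show ?thesis using constructible_preimage[OF h assms(1)] by simp
qed

lemma Omega_iff:
  "\<chi> \<in> Omega S \<longleftrightarrow> \<chi> \<in> characters S \<and>
     (\<forall>K. finite K \<and> K \<subseteq> constructible S \<longrightarrow>
        (\<exists>s\<in>carrier S. \<forall>X\<in>K. \<chi> X = (if s \<in> X then 1 else 0)))"
  (is "_ \<longleftrightarrow> _ \<and> ?fin")
proof -
  let ?J = "constructible S"
  let ?T = "product_topology (\<lambda>X. discrete_topology {0, 1::nat}) ?J"
  have sub: "characters S \<subseteq> topspace ?T" by (auto simp: characters_def)
  have carr: "carrier S \<in> ?J"
  proof -
    have "dom (left_translation S \<one>) = carrier S" by (auto simp: left_translation_def split: if_splits)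
    then show ?thesis using dom_in_constructible[OF left_inverse_hull.translation[OF one_closed]] by simp
  qed
  have pc: "principal_character S s \<in> characters S" if "s \<in> carrier S" for s
    using that carr constructible_Int
    by (auto simp: characters_def principal_character_def intro!: bexI[of _ "carrier S"])
  have "\<chi> \<in> Omega S \<longleftrightarrow> \<chi> \<in> characters S \<and>
     (\<forall>U. \<chi> \<in> U \<and> openin ?T U \<longrightarrow> (\<exists>s\<in>carrier S. principal_character S s \<in> U))"
  proof -
    have i: "characters S \<inter> principal_character S ` carrier S = principal_character S ` carrier S"
      using pc by blast
    show ?thesis
      unfolding Omega_def character_topology_def closure_of_subtopology i
      unfolding Int_iff in_closure_of using sub by blast
  qed
  also have "\<dots> \<longleftrightarrow> \<chi> \<in> characters S \<and> ?fin"
  proof (intro conj_cong refl iffI allI impI)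
    fix K assume chi: "\<chi> \<in> characters S" and K: "finite K \<and> K \<subseteq> ?J"
      and *: "\<forall>U. \<chi> \<in> U \<and> openin ?T U \<longrightarrow> (\<exists>s\<in>carrier S. principal_character S s \<in> U)"
    let ?U = "PiE ?J (\<lambda>X. if X \<in> K then {\<chi> X} else {0, 1})"
    have vals: "\<forall>X\<in>?J. \<chi> X \<in> {0, 1}" using chi by (auto simp: characters_def)
    have "finite {i \<in> ?J. (if i \<in> K then {\<chi> i} else {0, 1}) \<noteq> {0, 1}}"
      using K by (rule_tac finite_subset[of _ K]) auto
    then have "openin ?T ?U"
      using vals by (auto simp: openin_PiE_gen)
    moreover have "\<chi> \<in> ?U" using chi by (auto simp: characters_def)
    ultimately obtain s where s: "s \<in> carrier S" "principal_character S s \<in> ?U" using * by blast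
    have "\<chi> X = (if s \<in> X then 1 else 0)" if "X \<in> K" for X
    proof -
      have "principal_character S s X \<in> (if X \<in> K then {\<chi> X} else {0, 1})"
        using s K that by (blast dest: PiE_mem)
      then show ?thesis using that K by (auto simp: principal_character_def)
    qed
    then show "\<exists>s\<in>carrier S. \<forall>X\<in>K. \<chi> X = (if s \<in> X then 1 else 0)" using s by blast
  next
    fix U assume chi: "\<chi> \<in> characters S" and fin: ?fin and U: "\<chi> \<in> U \<and> openin ?T U"
    then obtain V where V: "finite {i \<in> ?J. V i \<noteq> {0, 1}}" "\<chi> \<in> PiE ?J V" "PiE ?J V \<subseteq> U"
      unfolding openin_product_topology_alt by fastforce
    then obtain s where s: "s \<in> carrier S"
        "\<forall>X\<in>{i \<in> ?J. V i \<noteq> {0, 1}}. \<chi> X = (if s \<in> X then 1 else 0)"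
      using fin by blast
    have "principal_character S s \<in> PiE ?J V"
    proof (rule PiE_I)
      fix X assume X: "X \<in> ?J"
      show "principal_character S s X \<in> V X"
      proof (cases "V X = {0, 1}")
        case False
        then have "principal_character S s X = \<chi> X" using X s by (simp add: principal_character_def)
        then show ?thesis using V X by auto
      qed (use X in \<open>auto simp: principal_character_def\<close>)
    qed (auto simp: principal_character_def)
    then show "\<exists>s\<in>carrier S. principal_character S s \<in> U" using V s by blast
  qed
  finally show ?thesis .
qed

lemma Omega_subset_characters: "\<chi> \<in> Omega S \<Longrightarrow> \<chi> \<in> characters S"
  unfolding Omega_iff by (rule conjunct1)

lemma Omega_approx:
  assumes "\<chi> \<in> Omega S" "finite K" "K \<subseteq> constructible S"
  shows "\<exists>s\<in>carrier S. \<forall>X\<in>K. \<chi> X = (if s \<in> X then 1 else 0)"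
proof -
  have "\<forall>K. finite K \<and> K \<subseteq> constructible S \<longrightarrow>
      (\<exists>s\<in>carrier S. \<forall>X\<in>K. \<chi> X = (if s \<in> X then 1 else 0))"
    using assms(1) unfolding Omega_iff by (rule conjunct2)
  then show ?thesis using assms(2,3) by (elim allE[of _ K] impE) auto
qed

lemma diff_in_constructible_bar:
  "X \<in> constructible S \<Longrightarrow> finite F \<Longrightarrow> F \<subseteq> constructible S \<Longrightarrow> X - \<Union>F \<in> constructible_bar S"
  unfolding constructible_bar_def by (rule UnI2, rule CollectI, intro exI conjI, rule refl)

lemma char_ext_diff:
  assumes chi: "\<chi> \<in> Omega S" and X: "X \<in> constructible S" and F: "finite F" "F \<subseteq> constructible S"
  shows "char_ext S \<chi> (X - \<Union>F) = (if \<chi> X = 1 \<and> (\<forall>Z\<in>F. \<chi> Z = 0) then 1 else 0)"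
proof -
  have "\<chi> X = 1 \<and> (\<forall>Z\<in>F. \<chi> Z = 0)"
    if Y: "Y \<in> constructible S" "finite H" "H \<subseteq> constructible S" "X - \<Union>F = Y - \<Union>H"
      "\<chi> Y = 1" "\<forall>Z\<in>H. \<chi> Z = 0" for Y H
  proof -
    obtain s where s: "\<forall>Z\<in>{X, Y} \<union> F \<union> H. \<chi> Z = (if s \<in> Z then 1 else 0)"
    proof -
      have "finite ({X, Y} \<union> F \<union> H)" "{X, Y} \<union> F \<union> H \<subseteq> constructible S"
        using X F Y(1-3) by simp_all
      from Omega_approx[OF chi this] show ?thesis using that by blast
    qed
    have s1: "s \<in> Z \<longleftrightarrow> \<chi> Z = 1" "s \<notin> Z \<longleftrightarrow> \<chi> Z = 0" if "Z \<in> {X, Y} \<union> F \<union> H" for Z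
      using bspec[OF s that] by simp_all
    have "s \<in> Y" using s1(1)[of Y] Y(5) by simp
    moreover have "\<forall>Z\<in>H. s \<notin> Z" using s1(2) Y(6) by blast
    ultimately have "s \<in> Y - \<Union>H" by blast
    then have "s \<in> X - \<Union>F" using Y(4) by simp
    then have "s \<in> X" "\<forall>Z\<in>F. s \<notin> Z" by blast+
    then show ?thesis using s1(1)[of X] s1(2) by blast
  qed
  note main = this
  have bar: "X - \<Union>F \<in> constructible_bar S" using X F by (rule diff_in_constructible_bar)
  have "(\<exists>Y H. Y \<in> constructible S \<and> finite H \<and> H \<subseteq> constructible S \<and>
      X - \<Union>F = Y - \<Union>H \<and> \<chi> Y = 1 \<and> (\<forall>Z\<in>H. \<chi> Z = 0)) \<longleftrightarrow> \<chi> X = 1 \<and> (\<forall>Z\<in>F. \<chi> Z = 0)"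
    (is "?l \<longleftrightarrow> ?r")
  proof
    assume ?l then show ?r by (elim exE conjE) (rule main)
  next
    assume ?r then show ?l using X F by (intro exI[of _ X] exI[of _ F] conjI refl) auto
  qed
  then show ?thesis unfolding char_ext_def restrict_apply'[OF bar] by (rule if_cong) (rule refl)+
qed

lemma char_ext_constructible:
  assumes "\<chi> \<in> Omega S" "X \<in> constructible S"
  shows "char_ext S \<chi> X = \<chi> X"
proof -
  have "\<chi> X \<in> {0, 1}" using Omega_subset_characters[OF assms(1)] assms(2) by (auto simp: characters_def)
  then show ?thesis using char_ext_diff[OF assms, of "{}"] by auto
qed

lemma constructible_bar_iff:
  "Y \<in> constructible_bar S \<longleftrightarrow>
     (\<exists>X F. X \<in> constructible S \<and> finite F \<and> F \<subseteq> constructible S \<and> Y = X - \<Union>F)"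
proof -
  have "\<exists>X F. X \<in> constructible S \<and> finite F \<and> F \<subseteq> constructible S \<and> Y = X - \<Union>F"
    if "Y \<in> constructible S"
    by (rule exI[of _ Y], rule exI[of _ "{}"]) (use that in simp)
  then show ?thesis unfolding constructible_bar_def by blast
qed

lemma constructible_barE:
  assumes "Y \<in> constructible_bar S"
  obtains X F where "X \<in> constructible S" "finite F" "F \<subseteq> constructible S" "Y = X - \<Union>F"
  using assms unfolding constructible_bar_iff by (elim exE conjE) (rule that)

lemma character_Int:
  assumes "\<chi> \<in> Omega S" "X \<in> constructible S" "Y \<in> constructible S" "\<chi> X = 1" "\<chi> Y = 1"
  shows "X \<inter> Y \<in> constructible S \<and> \<chi> (X \<inter> Y) = 1"
  using Omega_subset_characters[OF assms(1)] assms constructible_Int by (simp add: characters_def)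

lemma char_ext_Int:
  assumes chi: "\<chi> \<in> Omega S" and "X \<in> constructible_bar S" "Y \<in> constructible_bar S"
    "char_ext S \<chi> X = 1" "char_ext S \<chi> Y = 1"
  shows "X \<inter> Y \<in> constructible_bar S \<and> char_ext S \<chi> (X \<inter> Y) = 1"
proof -
  obtain X' F where X: "X' \<in> constructible S" "finite F" "F \<subseteq> constructible S" "X = X' - \<Union>F"
    by (rule constructible_barE[OF assms(2)])
  obtain Y' H where Y: "Y' \<in> constructible S" "finite H" "H \<subseteq> constructible S" "Y = Y' - \<Union>H"
    by (rule constructible_barE[OF assms(3)])
  have eq: "X \<inter> Y = (X' \<inter> Y') - \<Union>(F \<union> H)" using X Y by blast
  have "\<chi> X' = 1 \<and> (\<forall>Z\<in>F. \<chi> Z = 0)"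
    using assms(4) unfolding X(4) char_ext_diff[OF chi X(1-3)] by (metis zero_neq_one)
  moreover have "\<chi> Y' = 1 \<and> (\<forall>Z\<in>H. \<chi> Z = 0)"
    using assms(5) unfolding Y(4) char_ext_diff[OF chi Y(1-3)] by (metis zero_neq_one)
  ultimately have 1: "\<chi> X' = 1" "\<forall>Z\<in>F. \<chi> Z = 0" "\<chi> Y' = 1" "\<forall>Z\<in>H. \<chi> Z = 0"
    by blast+
  have 2: "X' \<inter> Y' \<in> constructible S" "\<chi> (X' \<inter> Y') = 1"
    using character_Int[OF chi X(1) Y(1)] 1(1,3) by blast+
  have 3: "finite (F \<union> H)" "F \<union> H \<subseteq> constructible S" using X Y by simp_all
  have "X \<inter> Y \<in> constructible_bar S" unfolding eq using 2(1) 3 by (rule diff_in_constructible_bar)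
  moreover have "char_ext S \<chi> (X \<inter> Y) = 1"
    unfolding eq char_ext_diff[OF chi 2(1) 3] using 1 2 by auto
  ultimately show ?thesis ..
qed

lemma germ_rel_iff:
  "((g, \<chi>), (h, \<psi>)) \<in> germ_rel S \<longleftrightarrow>
     (g, \<chi>) \<in> germ_pairs S \<and> (h, \<psi>) \<in> germ_pairs S \<and> \<chi> = \<psi> \<and>
     (\<exists>A\<in>constructible S. A \<subseteq> dom g \<inter> dom h \<and> \<chi> A = 1 \<and> (\<forall>t\<in>A. g t = h t))"
proof -
  have "A \<subseteq> dom g \<inter> dom h \<and> \<chi> A = 1 \<and> g |` A = h |` A \<longleftrightarrow>
      A \<subseteq> dom g \<inter> dom h \<and> \<chi> A = 1 \<and> (\<forall>t\<in>A. g t = h t)" for A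
    using restrict_eq_iff by blast
  then show ?thesis unfolding germ_rel_def by simp
qed

lemma equiv_germ_rel: "equiv (germ_pairs S) (germ_rel S)"
proof (rule equivI)
  show "refl_on (germ_pairs S) (germ_rel S)"
  proof (rule refl_onI, clarify)
    fix g \<chi> assume p: "(g, \<chi>) \<in> germ_pairs S"
    then have "dom g \<in> constructible S" "\<chi> (dom g) = 1" by (auto simp: germ_pairs_def)
    then show "((g, \<chi>), (g, \<chi>)) \<in> germ_rel S" unfolding germ_rel_iff using p by blast
  qed
  show "germ_rel S \<subseteq> germ_pairs S \<times> germ_pairs S" by (auto simp: germ_rel_def)
  show "sym (germ_rel S)" 
  proof (rule symI, clarify)
    fix g \<chi> h \<psi> assume "((g, \<chi>), (h, \<psi>)) \<in> germ_rel S"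
    then show "((h, \<psi>), (g, \<chi>)) \<in> germ_rel S" unfolding germ_rel_iff by (metis inf_commute)
  qed
  show "trans (germ_rel S)"
  proof (rule transI, clarsimp simp: germ_rel_iff)
    fix g h k \<chi> A B
    assume a: "(g, \<chi>) \<in> germ_pairs S" "A \<in> constructible S" "B \<in> constructible S"
      "A \<subseteq> dom g" "A \<subseteq> dom h" "B \<subseteq> dom h" "B \<subseteq> dom k" "\<chi> A = Suc 0" "\<chi> B = Suc 0"
      "\<forall>t\<in>A. g t = h t" "\<forall>t\<in>B. h t = k t"
    then show "\<exists>A\<in>constructible S. A \<subseteq> dom g \<and> A \<subseteq> dom k \<and> \<chi> A = Suc 0 \<and> (\<forall>t\<in>A. g t = k t)"
      using character_Int[of \<chi> A B] by (intro bexI[of _ "A \<inter> B"]) (auto simp: germ_pairs_def)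
  qed
qed

lemma germ_eq_iff:
  assumes "(g, \<chi>) \<in> germ_pairs S" "(h, \<psi>) \<in> germ_pairs S"
  shows "germ S g \<chi> = germ S h \<psi> \<longleftrightarrow> ((g, \<chi>), (h, \<psi>)) \<in> germ_rel S"
  unfolding germ_def by (rule eq_equiv_class_iff[OF equiv_germ_rel assms])

lemma carrier_groupoid_GP:
  "carrier (groupoid_GP S) = {germ S g \<chi> | g \<chi>. (g, \<chi>) \<in> germ_pairs S}"
  by (auto simp: groupoid_GP_def quotient_def germ_def)

lemma translate_char_in_Omega:
  assumes h: "(h, \<psi>) \<in> germ_pairs S"
  shows "translate_char S h \<psi> \<in> Omega S"
proof -
  let ?J = "constructible S" and ?p = "preimage h"
  have hI: "h \<in> left_inverse_hull S" and psi: "\<psi> \<in> Omega S" and d: "\<psi> (dom h) = 1"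
    using h by (auto simp: germ_pairs_def)
  note pJ = constructible_preimage[OF hI]
  have ch: "\<psi> \<in> characters S" by (rule Omega_subset_characters[OF psi])
  have int: "?p (X \<inter> Y) = ?p X \<inter> ?p Y" for X Y by auto
  have dd: "?p (dom (pinv h)) = dom h"
    using left_inverse_hull_partial_bij[OF hI] by (auto simp: pinv_eq_Some) (metis domI pinv_eq_Some)
  have "dom (pinv h) \<in> ?J" using hI by (blast intro: left_inverse_hull.inverse)
  then have "\<exists>X\<in>?J. translate_char S h \<psi> X \<noteq> 0"
    using dd d by (auto simp: translate_char_def intro!: bexI[of _ "dom (pinv h)"])
  then have "translate_char S h \<psi> \<in> characters S"
    using ch pJ by (auto simp: characters_def translate_char_def constructible_Int int PiE_iff)
  moreover have "\<exists>s\<in>carrier S. \<forall>X\<in>K. translate_char S h \<psi> X = (if s \<in> X then 1 else 0)"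
    if K: "finite K" "K \<subseteq> ?J" for K
  proof -
    obtain t where t: "\<forall>X\<in>insert (dom h) (?p ` K). \<psi> X = (if t \<in> X then 1 else 0)"
    proof -
      have "finite (insert (dom h) (?p ` K))" "insert (dom h) (?p ` K) \<subseteq> ?J"
        using K pJ dom_in_constructible[OF hI] by auto
      from Omega_approx[OF psi this] show ?thesis using that by blast
    qed
    have "t \<in> dom h" using bspec[OF t insertI1] d by (metis zero_neq_one)
    then obtain s where s: "h t = Some s" by blast
    then have "s \<in> carrier S" using left_inverse_hull_partial_bij[OF hI] by (auto intro: ranI)
    moreover have "\<forall>X\<in>K. translate_char S h \<psi> X = (if s \<in> X then 1 else 0)"
    proof
      fix X assume X: "X \<in> K"
      then show "translate_char S h \<psi> X = (if s \<in> X then 1 else 0)"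
      proof -
        have "translate_char S h \<psi> X = \<psi> (?p X)" using X K by (auto simp: translate_char_def)
        also have "\<dots> = (if t \<in> ?p X then 1 else 0)" using X by (intro bspec[OF t]) blast
        also have "t \<in> ?p X \<longleftrightarrow> s \<in> X" by (simp add: s)
        finally show ?thesis .
      qed
    qed
    ultimately show ?thesis by blast
  qed
  ultimately show ?thesis unfolding Omega_iff by blast
qed

lemma translate_char_cong:
  assumes "\<psi> \<in> Omega S" "h \<in> left_inverse_hull S" "k \<in> left_inverse_hull S"
    "B \<in> constructible_bar S" "char_ext S \<psi> B = 1" "\<And>t. t \<in> B \<Longrightarrow> h t = k t"
  shows "translate_char S h \<psi> = translate_char S k \<psi>"
proof
  fix X
  obtain Y F where Y: "Y \<in> constructible S" "finite F" "F \<subseteq> constructible S" "B = Y - \<Union>F"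
    by (rule constructible_barE[OF assms(4)])
  have one: "\<psi> Y = 1 \<and> (\<forall>Z\<in>F. \<psi> Z = 0)"
    using assms(5) unfolding Y(4) char_ext_diff[OF assms(1) Y(1-3)] by (metis zero_neq_one)
  show "translate_char S h \<psi> X = translate_char S k \<psi> X"
  proof (cases "X \<in> constructible S")
    case True
    obtain s where s: "\<forall>Z\<in>{Y, preimage h X, preimage k X} \<union> F. \<psi> Z = (if s \<in> Z then 1 else 0)"
    proof -
      have "finite ({Y, preimage h X, preimage k X} \<union> F)"
        "{Y, preimage h X, preimage k X} \<union> F \<subseteq> constructible S"
        using Y(1-3) constructible_preimage[OF assms(2) True] constructible_preimage[OF assms(3) True]
        by simp_all
      from Omega_approx[OF assms(1) this] show ?thesis using that by blast
    qed
    have s1: "s \<in> Z \<longleftrightarrow> \<psi> Z = 1" "s \<notin> Z \<longleftrightarrow> \<psi> Z = 0"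
      if "Z \<in> {Y, preimage h X, preimage k X} \<union> F" for Z
      using bspec[OF s that] by simp_all
    have "s \<in> Y" using s1(1)[of Y] one by simp
    moreover have "\<forall>Z\<in>F. s \<notin> Z" using s1(2) one by blast
    ultimately have "s \<in> B" unfolding Y(4) by blast
    then have "s \<in> preimage h X \<longleftrightarrow> s \<in> preimage k X" using assms(6) by simp
    then have "\<psi> (preimage h X) = \<psi> (preimage k X)"
      using bspec[OF s, of "preimage h X"] bspec[OF s, of "preimage k X"]
      by (simp del: in_preimage)
    then show ?thesis using True by (simp add: translate_char_def)
  qed (simp add: translate_char_def)
qed

lemma germ_product_pair:
  assumes "(g, translate_char S h \<psi>) \<in> germ_pairs S" "(h, \<psi>) \<in> germ_pairs S"
  shows "(g \<circ>\<^sub>m h, \<psi>) \<in> germ_pairs S"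
proof -
  have 1: "g \<in> left_inverse_hull S" "h \<in> left_inverse_hull S" "\<psi> \<in> Omega S"
    "translate_char S h \<psi> (dom g) = 1"
    using assms by (simp_all add: germ_pairs_def)
  then have "\<psi> (dom (g \<circ>\<^sub>m h)) = 1"
    using dom_in_constructible[OF 1(1)] by (simp add: dom_map_comp translate_char_def)
  then show ?thesis using left_inverse_hull.compose[OF 1(1,2)] 1(3) by (simp add: germ_pairs_def)
qed

lemma is_germ_product_unique:
  assumes "is_germ_product S C D E" "is_germ_product S C D E'"
  shows "E = E'"
proof -
  obtain g \<chi> h \<psi> where 1: "(g, \<chi>) \<in> germ_pairs S" "(h, \<psi>) \<in> germ_pairs S" "C = germ S g \<chi>"
    "D = germ S h \<psi>" "\<chi> = translate_char S h \<psi>" "E = germ S (g \<circ>\<^sub>m h) \<psi>"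
    using assms(1) by (auto simp: is_germ_product_def)
  obtain g' \<chi>' h' \<psi>' where 2: "(g', \<chi>') \<in> germ_pairs S" "(h', \<psi>') \<in> germ_pairs S" "C = germ S g' \<chi>'"
    "D = germ S h' \<psi>'" "\<chi>' = translate_char S h' \<psi>'" "E' = germ S (g' \<circ>\<^sub>m h') \<psi>'"
    using assms(2) by (auto simp: is_germ_product_def)
  have r: "((g, \<chi>), (g', \<chi>')) \<in> germ_rel S" "((h, \<psi>), (h', \<psi>')) \<in> germ_rel S"
    using 1 2 germ_eq_iff by metis+
  then obtain A B where A: "A \<in> constructible S" "A \<subseteq> dom g \<inter> dom g'" "\<chi> A = 1" "\<forall>t\<in>A. g t = g' t"
    and B: "B \<in> constructible S" "B \<subseteq> dom h \<inter> dom h'" "\<psi> B = 1" "\<forall>t\<in>B. h t = h' t"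
    and eq: "\<chi>' = \<chi>" "\<psi>' = \<psi>"
    unfolding germ_rel_iff by blast
  have psi: "\<psi> \<in> Omega S" and h: "h \<in> left_inverse_hull S" using 1 by (auto simp: germ_pairs_def)
  have A': "preimage h A \<in> constructible S" "\<psi> (preimage h A) = 1"
    using constructible_preimage[OF h] A 1 by (auto simp: translate_char_def)
  let ?K = "preimage h A \<inter> B"
  have K: "?K \<in> constructible S" "\<psi> ?K = 1" using character_Int[OF psi] A' B by auto
  have p: "(g \<circ>\<^sub>m h, \<psi>) \<in> germ_pairs S" "(g' \<circ>\<^sub>m h', \<psi>) \<in> germ_pairs S"
    using germ_product_pair 1 2 eq by metis+
  have e: "(g \<circ>\<^sub>m h) t = (g' \<circ>\<^sub>m h') t \<and> t \<in> dom (g \<circ>\<^sub>m h) \<inter> dom (g' \<circ>\<^sub>m h')" if t: "t \<in> ?K" for t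
  proof -
    obtain u where u: "h t = Some u" "u \<in> A" using t by auto
    then have "h' t = Some u" using t B by auto
    moreover obtain v where v: "g u = Some v" using u A by blast
    then have "g' u = Some v" using u A by simp
    ultimately show ?thesis using u v by (simp add: domIff)
  qed
  have "((g \<circ>\<^sub>m h, \<psi>), (g' \<circ>\<^sub>m h', \<psi>)) \<in> germ_rel S"
    unfolding germ_rel_iff by (intro conjI bexI[OF _ K(1)] p refl K(2) subsetI ballI) (use e in blast)+
  then show ?thesis using germ_eq_iff p 1 2 eq by metis
qed

lemma arrow_product_groupoid_GP:
  "arrow_product (groupoid_GP S) C D = Some E \<longleftrightarrow> is_germ_product S C D E"
proof (cases "\<exists>E. is_germ_product S C D E")
  case True
  then obtain E' where E': "is_germ_product S C D E'" by blast
  then have "(THE E. is_germ_product S C D E) = E'"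
    by (rule the_equality) (rule is_germ_product_unique[OF _ E'])
  then have "arrow_product (groupoid_GP S) C D = Some E'" using True by (simp add: groupoid_GP_def)
  then show ?thesis using E' is_germ_product_unique[OF E'] by (metis option.inject)
next
  case False
  then show ?thesis by (auto simp: groupoid_GP_def)
qed

lemma sim2_germ_iff:
  assumes p: "(g, \<chi>) \<in> germ_pairs S" "(h, \<psi>) \<in> germ_pairs S"
  shows "(germ S g \<chi>, germ S h \<psi>) \<in> sim2 S \<longleftrightarrow> \<chi> = \<psi> \<and>
    (\<exists>X\<in>constructible_bar S. X \<subseteq> dom g \<inter> dom h \<and> char_ext S \<chi> X = 1 \<and> (\<forall>t\<in>X. g t = h t))"
    (is "?l \<longleftrightarrow> ?r")
proof
  assume ?r then show ?l unfolding sim2_def using p restrict_eq_iff by blast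
next
  assume ?l
  then obtain g' h' \<omega> X where 1: "germ S g \<chi> = germ S g' \<omega>" "germ S h \<psi> = germ S h' \<omega>"
    "(g', \<omega>) \<in> germ_pairs S" "(h', \<omega>) \<in> germ_pairs S" "X \<in> constructible_bar S"
    "X \<subseteq> dom g' \<inter> dom h'" "char_ext S \<omega> X = 1" "\<forall>t\<in>X. g' t = h' t"
    unfolding sim2_def using restrict_eq_iff by blast
  have r: "((g, \<chi>), (g', \<omega>)) \<in> germ_rel S" "((h, \<psi>), (h', \<omega>)) \<in> germ_rel S"
    using 1 p germ_eq_iff by metis+
  then obtain A B where A: "A \<in> constructible S" "A \<subseteq> dom g \<inter> dom g'" "\<chi> A = 1" "\<forall>t\<in>A. g t = g' t"
    and B: "B \<in> constructible S" "B \<subseteq> dom h \<inter> dom h'" "\<psi> B = 1" "\<forall>t\<in>B. h t = h' t"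
    and eq: "\<chi> = \<omega>" "\<psi> = \<omega>"
    unfolding germ_rel_iff by blast
  have om: "\<omega> \<in> Omega S" using p eq by (auto simp: germ_pairs_def)
  have AB: "A \<inter> B \<in> constructible S" "\<omega> (A \<inter> B) = 1" using character_Int[OF om] A B eq by auto
  then have "A \<inter> B \<in> constructible_bar S" "char_ext S \<omega> (A \<inter> B) = 1"
    using char_ext_constructible[OF om] by (auto simp: constructible_bar_def)
  then have "X \<inter> (A \<inter> B) \<in> constructible_bar S" "char_ext S \<omega> (X \<inter> (A \<inter> B)) = 1"
    using char_ext_Int[OF om] 1 by blast+
  moreover have "X \<inter> (A \<inter> B) \<subseteq> dom g \<inter> dom h" "\<forall>t\<in>X \<inter> (A \<inter> B). g t = h t"
    using A B 1 by auto
  ultimately show ?r using eq by blast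
qed

lemma equiv_sim2: "equiv (carrier (groupoid_GP S)) (sim2 S)"
proof (rule equivI)
  show "sim2 S \<subseteq> carrier (groupoid_GP S) \<times> carrier (groupoid_GP S)"
    by (auto simp: sim2_def carrier_groupoid_GP)
  show "refl_on (carrier (groupoid_GP S)) (sim2 S)"
  proof (rule refl_onI)
    fix C assume "C \<in> carrier (groupoid_GP S)"
    then obtain g \<chi> where C: "C = germ S g \<chi>" "(g, \<chi>) \<in> germ_pairs S" by (auto simp: carrier_groupoid_GP)
    then have chi: "\<chi> \<in> Omega S" "\<chi> (dom g) = 1" and d: "dom g \<in> constructible S"
      by (auto simp: germ_pairs_def)
    then have "char_ext S \<chi> (dom g) = 1" by (simp add: char_ext_constructible)
    moreover have "dom g \<in> constructible_bar S" using d by (simp add: constructible_bar_def)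
    ultimately show "(C, C) \<in> sim2 S" unfolding C(1) sim2_germ_iff[OF C(2,2)] by blast
  qed
  show "sym (sim2 S)"
  proof (rule symI)
    fix C D assume "(C, D) \<in> sim2 S"
    then obtain g h \<chi> where "C = germ S g \<chi>" "D = germ S h \<chi>" "(g, \<chi>) \<in> germ_pairs S"
      "(h, \<chi>) \<in> germ_pairs S" "\<exists>X\<in>constructible_bar S. X \<subseteq> dom g \<inter> dom h \<and> char_ext S \<chi> X = 1 \<and> g |` X = h |` X"
      unfolding sim2_def by blast
    then show "(D, C) \<in> sim2 S"
      unfolding sim2_def Int_commute[of "dom g"] by (metis (mono_tags, lifting) mem_Collect_eq)
  qed
  show "trans (sim2 S)"
  proof (rule transI)
    fix C D E assume CD: "(C, D) \<in> sim2 S" and DE: "(D, E) \<in> sim2 S"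
    obtain g h \<chi> where 1: "C = germ S g \<chi>" "D = germ S h \<chi>" "(g, \<chi>) \<in> germ_pairs S" "(h, \<chi>) \<in> germ_pairs S"
      using CD unfolding sim2_def by blast
    obtain k \<psi> where 2: "E = germ S k \<psi>" "(k, \<psi>) \<in> germ_pairs S"
      using DE unfolding sim2_def by blast
    obtain X where X: "X\<in>constructible_bar S" "X \<subseteq> dom g \<inter> dom h" "char_ext S \<chi> X = 1" "\<forall>t\<in>X. g t = h t"
      using CD unfolding 1(1,2) sim2_germ_iff[OF 1(3,4)] by blast
    obtain Y where Y: "Y\<in>constructible_bar S" "Y \<subseteq> dom h \<inter> dom k" "char_ext S \<chi> Y = 1" "\<forall>t\<in>Y. h t = k t"
      and eq: "\<chi> = \<psi>"
      using DE unfolding 1(2) 2(1) sim2_germ_iff[OF 1(4) 2(2)] by blast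
    have om: "\<chi> \<in> Omega S" using 1 by (auto simp: germ_pairs_def)
    have "X \<inter> Y \<in> constructible_bar S" "char_ext S \<chi> (X \<inter> Y) = 1"
      using char_ext_Int[OF om X(1) Y(1) X(3) Y(3)] by blast+
    moreover have "X \<inter> Y \<subseteq> dom g \<inter> dom k" "\<forall>t\<in>X \<inter> Y. g t = k t" using X Y by auto
    ultimately show "(C, E) \<in> sim2 S" unfolding 1(1) 2(1) sim2_germ_iff[OF 1(3) 2(2)] using eq by blast
  qed
qed

lemma char_ext_preimage:
  assumes h: "(h, \<psi>) \<in> germ_pairs S" and X: "X \<in> constructible_bar S"
  shows "preimage h X \<in> constructible_bar S"
    and "char_ext S \<psi> (preimage h X) = char_ext S (translate_char S h \<psi>) X"
proof -
  have hI: "h \<in> left_inverse_hull S" and psi: "\<psi> \<in> Omega S" using h by (simp_all add: germ_pairs_def)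
  obtain Y F where Y: "Y \<in> constructible S" "finite F" "F \<subseteq> constructible S" "X = Y - \<Union>F"
    by (rule constructible_barE[OF X])
  have eq: "preimage h X = preimage h Y - \<Union>(preimage h ` F)"
    unfolding Y(4) preimage_def by (auto; metis option.inject)
  have F: "finite (preimage h ` F)" "preimage h ` F \<subseteq> constructible S"
    using Y constructible_preimage[OF hI] by blast+
  note pY = constructible_preimage[OF hI Y(1)]
  show "preimage h X \<in> constructible_bar S"
    unfolding eq using pY F by (rule diff_in_constructible_bar)
  have t: "translate_char S h \<psi> Z = \<psi> (preimage h Z)" if "Z \<in> constructible S" for Z
    using that by (simp add: translate_char_def)
  have "(\<forall>Z\<in>F. translate_char S h \<psi> Z = 0) \<longleftrightarrow> (\<forall>Z\<in>preimage h ` F. \<psi> Z = 0)"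
    using t Y(3) by (auto simp: subset_iff)
  then show "char_ext S \<psi> (preimage h X) = char_ext S (translate_char S h \<psi>) X"
    unfolding eq char_ext_diff[OF psi pY F]
    unfolding Y(4) char_ext_diff[OF translate_char_in_Omega[OF h] Y(1-3)] t[OF Y(1)] by (simp only:)
qed

lemma sim2_product:
  assumes "is_germ_product S C D E" "is_germ_product S C' D' E'" "(C, C') \<in> sim2 S" "(D, D') \<in> sim2 S"
  shows "(E, E') \<in> sim2 S"
proof -
  obtain g \<chi> h \<psi> where 1: "(g, \<chi>) \<in> germ_pairs S" "(h, \<psi>) \<in> germ_pairs S" "C = germ S g \<chi>"
    "D = germ S h \<psi>" "\<chi> = translate_char S h \<psi>" "E = germ S (g \<circ>\<^sub>m h) \<psi>"
    using assms(1) unfolding is_germ_product_def by blast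
  obtain g' \<chi>' h' \<psi>' where 2: "(g', \<chi>') \<in> germ_pairs S" "(h', \<psi>') \<in> germ_pairs S" "C' = germ S g' \<chi>'"
    "D' = germ S h' \<psi>'" "\<chi>' = translate_char S h' \<psi>'" "E' = germ S (g' \<circ>\<^sub>m h') \<psi>'"
    using assms(2) unfolding is_germ_product_def by blast
  obtain X where X: "X \<in> constructible_bar S" "X \<subseteq> dom g \<inter> dom g'" "char_ext S \<chi> X = 1" "\<forall>t\<in>X. g t = g' t"
    using assms(3) unfolding 1(3) 2(3) sim2_germ_iff[OF 1(1) 2(1)] by blast
  obtain Y where Y: "Y \<in> constructible_bar S" "Y \<subseteq> dom h \<inter> dom h'" "char_ext S \<psi> Y = 1" "\<forall>t\<in>Y. h t = h' t"
    and eq: "\<psi> = \<psi>'"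
    using assms(4) unfolding 1(4) 2(4) sim2_germ_iff[OF 1(2) 2(2)] by blast
  have psi: "\<psi> \<in> Omega S" using 1(2) by (simp add: germ_pairs_def)
  have p: "(g \<circ>\<^sub>m h, \<psi>) \<in> germ_pairs S" "(g' \<circ>\<^sub>m h', \<psi>') \<in> germ_pairs S"
    using germ_product_pair[OF 1(1)[unfolded 1(5)] 1(2)] germ_product_pair[OF 2(1)[unfolded 2(5)] 2(2)] .
  let ?Z = "preimage h X \<inter> Y"
  have "char_ext S \<psi> (preimage h X) = 1"
    using char_ext_preimage(2)[OF 1(2) X(1)] X(3) 1(5) by simp
  then have Z: "?Z \<in> constructible_bar S" "char_ext S \<psi> ?Z = 1"
    using char_ext_Int[OF psi char_ext_preimage(1)[OF 1(2) X(1)] Y(1) _ Y(3)] by blast+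
  have e: "(g \<circ>\<^sub>m h) t = (g' \<circ>\<^sub>m h') t \<and> t \<in> dom (g \<circ>\<^sub>m h) \<inter> dom (g' \<circ>\<^sub>m h')" if t: "t \<in> ?Z" for t
  proof -
    obtain u where u: "h t = Some u" "u \<in> X" using t by auto
    then have "h' t = Some u" using t Y by auto
    moreover obtain v where v: "g u = Some v" using u X by blast
    then have "g' u = Some v" using u X by simp
    ultimately show ?thesis using u v by (simp add: domIff)
  qed
  show ?thesis
    unfolding 1(6) 2(6) sim2_germ_iff[OF p]
    by (intro conjI eq bexI[OF _ Z(1)] Z(2) subsetI ballI) (use e in blast)+
qed

lemma is_quot_product_unique:
  assumes "is_quot_product S P Q R" "is_quot_product S P Q R'"
  shows "R = R'"
proof -
  obtain C D E where 1: "C \<in> carrier (groupoid_GP S)" "D \<in> carrier (groupoid_GP S)"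
    "P = germ_quotient S C" "Q = germ_quotient S D" "is_germ_product S C D E" "R = germ_quotient S E"
    using assms(1) unfolding is_quot_product_def arrow_product_groupoid_GP by blast
  obtain C' D' E' where 2: "C' \<in> carrier (groupoid_GP S)" "D' \<in> carrier (groupoid_GP S)"
    "P = germ_quotient S C'" "Q = germ_quotient S D'" "is_germ_product S C' D' E'" "R' = germ_quotient S E'"
    using assms(2) unfolding is_quot_product_def arrow_product_groupoid_GP by blast
  have "(C, C') \<in> sim2 S"
    using 1(3) 2(3) eq_equiv_class_iff[OF equiv_sim2 1(1) 2(1)] by (simp add: germ_quotient_def)
  moreover have "(D, D') \<in> sim2 S"
    using 1(4) 2(4) eq_equiv_class_iff[OF equiv_sim2 1(2) 2(2)] by (simp add: germ_quotient_def)
  ultimately have "(E, E') \<in> sim2 S" using sim2_product[OF 1(5) 2(5)] by blast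
  then show ?thesis
    unfolding 1(6) 2(6) germ_quotient_def by (rule equiv_class_eq[OF equiv_sim2])
qed

end

end

theory Submission
  imports Defs "HOL-Combinatorics.Transposition"
begin

text \<open>
  Let \<open>S\<close> be generated by \<open>a\<close>, \<open>b\<close> and \<open>z\<^sub>0, z\<^sub>1, \<dots>\<close> subject to \<open>a z\<^sub>k = b z\<^bsub>\<sigma>(k)\<^esub>\<close>, where
  \<open>\<sigma>\<close> is the transposition of \<open>0\<close> and \<open>1\<close>. Then \<open>g = b\<inverse>a\<close> has domain \<open>\<Union>\<^sub>k z\<^sub>kS\<close>; it exchanges
  \<open>z\<^sub>0\<close> and \<open>z\<^sub>1\<close> and is the identity on \<open>dom g - (z\<^sub>0S \<union> z\<^sub>1S)\<close>. Every constructible ideal contains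
  either finitely many or all of the \<open>z\<^sub>k\<close>, so their principal characters converge to a character \<open>\<chi>\<close>, which sees
  \<open>dom g\<close> but neither \<open>z\<^sub>0S\<close> nor \<open>z\<^sub>1S\<close>. Hence \<open>[g, \<chi>] \<sim>\<^sub>2 [1, \<chi>]\<close>, whereas a
  constructible ideal \<open>A\<close> with \<open>\<chi>(A) = 1\<close> contains \<open>z\<^sub>0\<close>, which \<open>g\<close> moves.
\<close>

section \<open>Constructible ideals, limit characters and a criterion for non-injectivity\<close>

context left_cancellative_monoid
begin

lemma pinv_eq_Some_hull:
  "g \<in> left_inverse_hull S \<Longrightarrow> pinv g y = Some x \<longleftrightarrow> g x = Some y"
  by (intro pinv_eq_Some left_inverse_hull_partial_bij)

lemma left_translation_eq_Some:
  "left_translation S s t = Some u \<longleftrightarrow> t \<in> carrier S \<and> u = s \<otimes> t"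
  by (auto simp: left_translation_def)

lemma pinv_left_translation_eq_Some:
  "s \<in> carrier S \<Longrightarrow> pinv (left_translation S s) u = Some t \<longleftrightarrow> t \<in> carrier S \<and> u = s \<otimes> t"
  by (simp add: pinv_eq_Some_hull left_inverse_hull.translation left_translation_eq_Some)

lemma principal_right_ideal_constructible:
  assumes "s \<in> carrier S"
  shows "(\<otimes>) s ` carrier S \<in> constructible S"
proof -
  have "dom (pinv (left_translation S s)) = (\<otimes>) s ` carrier S"
    using pinv_left_translation_eq_Some[OF assms] by (auto simp: dom_def)
  then show ?thesis
    using dom_in_constructible[OF left_inverse_hull.inverse[OF left_inverse_hull.translation[OF assms]]]
    by simp
qed

text \<open>A constructible ideal is the preimage of the whole monoid under some element of the
  hull. Preimages under a translation and under its inverse are the two operations in the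
  hypotheses.\<close>

lemma constructible_induct [consumes 1, case_names carrier preimage image]:
  assumes X: "X \<in> constructible S"
    and carrier: "Q (carrier S)"
    and pre: "\<And>s X. s \<in> carrier S \<Longrightarrow> X \<subseteq> carrier S \<Longrightarrow> Q X \<Longrightarrow> Q {t \<in> carrier S. s \<otimes> t \<in> X}"
    and im: "\<And>s X. s \<in> carrier S \<Longrightarrow> X \<subseteq> carrier S \<Longrightarrow> Q X \<Longrightarrow> Q ((\<otimes>) s ` X)"
  shows "Q X"
proof -
  \<comment> \<open>Proving this for \<open>g\<close> and \<open>pinv g\<close> together makes the
    inverse case a mere exchange of the two halves.\<close>
  let ?inv = "\<lambda>g. \<forall>Y. Y \<subseteq> carrier S \<and> Q Y \<longrightarrow> Q (preimage g Y)"
  have hull: "?inv g \<and> ?inv (pinv g)" if "g \<in> left_inverse_hull S" for g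
    using that
  proof induction
    case (translation s)
    have "preimage (left_translation S s) Y = {t \<in> carrier S. s \<otimes> t \<in> Y}" for Y
      by (auto simp: left_translation_eq_Some)
    moreover have "preimage (pinv (left_translation S s)) Y = (\<otimes>) s ` Y" if "Y \<subseteq> carrier S" for Y
      using that by (force simp: pinv_left_translation_eq_Some[OF translation])
    ultimately show ?case using pre im translation by simp
  next
    case (inverse g)
    have "pinv (pinv g) = g"
    proof (intro ext)
      fix x
      have "pinv (pinv g) x = Some y \<longleftrightarrow> g x = Some y" for y
        using inverse.hyps by (simp add: pinv_eq_Some_hull left_inverse_hull.inverse)
      then show "pinv (pinv g) x = g x" by (metis option.exhaust)
    qed
    then show ?case using inverse.IH by simp
  next
    case (compose g h)
    have sub: "preimage k Y \<subseteq> carrier S" if "k \<in> left_inverse_hull S" for k Y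
      using left_inverse_hull_partial_bij(2)[OF that] by fastforce
    have gh: "g \<circ>\<^sub>m h \<in> left_inverse_hull S"
      using compose.hyps by (rule left_inverse_hull.compose)
    have "preimage (g \<circ>\<^sub>m h) Y = preimage h (preimage g Y)" for Y
      by (auto simp: map_comp_Some_iff)
    moreover have "preimage (pinv (g \<circ>\<^sub>m h)) Y = preimage (pinv g) (preimage (pinv h) Y)" for Y
      using compose.hyps gh
      by (simp add: preimage_def pinv_eq_Some_hull map_comp_Some_iff del: in_preimage) blast
    moreover have "preimage g Y \<subseteq> carrier S" "preimage (pinv h) Y \<subseteq> carrier S" for Y
      using sub compose.hyps left_inverse_hull.inverse by blast+
    ultimately show ?case using compose.IH by simp
  qed
  obtain g where g: "g \<in> left_inverse_hull S" "X = dom g"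
    using X by (auto simp: constructible_def)
  have "preimage g (carrier S) = dom g"
    using left_inverse_hull_partial_bij(3)[OF g(1)] by (auto intro: ranI)
  then show ?thesis using hull[OF g(1)] carrier g(2) by (metis order_refl)
qed

text \<open>A finite set \<open>K\<close> of ideals excludes only finitely many \<open>k\<close>,
  namely those with \<open>z k\<close> in a member of \<open>K\<close> that does not contain all of
  \<open>range z\<close>. For any other \<open>k\<close> the principal character of
  \<open>z k\<close> agrees with this one on \<open>K\<close>.\<close>

lemma limit_character:
  fixes z :: "nat \<Rightarrow> 'a"
  assumes z: "range z \<subseteq> carrier S"
    and dich: "\<And>X. X \<in> constructible S \<Longrightarrow> finite {k. z k \<in> X} \<or> range z \<subseteq> X"
  shows "(\<lambda>X\<in>constructible S. if range z \<subseteq> X then 1 else 0) \<in> Omega S" (is "?\<chi> \<in> _")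
  unfolding Omega_iff
proof (intro conjI allI impI)
  have "carrier S = (\<otimes>) \<one> ` carrier S" by (force intro: image_eqI)
  then have "carrier S \<in> constructible S"
    using principal_right_ideal_constructible[OF one_closed] by simp
  then show "?\<chi> \<in> characters S"
    using z constructible_Int by (auto simp: characters_def intro!: bexI[of _ "carrier S"])
next
  fix K assume K: "finite K \<and> K \<subseteq> constructible S"
  let ?F = "\<Union>X\<in>{X \<in> K. \<not> range z \<subseteq> X}. {k. z k \<in> X}"
  have "finite ?F" using K dich by auto
  then obtain k where "k \<notin> ?F" using ex_new_if_finite[OF infinite_UNIV_nat] by blast
  then have "\<forall>X\<in>K. ?\<chi> X = (if z k \<in> X then 1 else 0)"
    using K by (auto simp: subset_iff)
  then show "\<exists>s\<in>carrier S. \<forall>X\<in>K. ?\<chi> X = (if s \<in> X then 1 else 0)"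
    using z by blast
qed

text \<open>Isolates what the argument needs from the monoid: \<open>lcm\<close> confines the domain
  of b^-1 a to the union of the ideals generated by the \<open>z k\<close>, \<open>sep\<close> keeps
  these generators apart, and \<open>dich\<close> provides the limit character.\<close>

lemma not_inj_on_germ_quotient:
  fixes z :: "nat \<Rightarrow> 'a"
  assumes a: "a \<in> carrier S" and b: "b \<in> carrier S" and z: "range z \<subseteq> carrier S"
    and sep: "\<And>j k. z k \<in> (\<otimes>) (z j) ` carrier S \<Longrightarrow> k = j"
    and swap: "\<And>k. a \<otimes> z k = b \<otimes> z (transpose 0 1 k)"
    and lcm: "\<And>s t. s \<in> carrier S \<Longrightarrow> t \<in> carrier S \<Longrightarrow> a \<otimes> s = b \<otimes> t \<Longrightarrow>
      \<exists>k. s \<in> (\<otimes>) (z k) ` carrier S"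
    and dich: "\<And>X. X \<in> constructible S \<Longrightarrow> finite {k. z k \<in> X} \<or> range z \<subseteq> X"
  shows "\<not> inj_on (germ_quotient S) (carrier (groupoid_GP S))"
proof
  assume inj: "inj_on (germ_quotient S) (carrier (groupoid_GP S))"
  define g where "g = pinv (left_translation S b) \<circ>\<^sub>m left_translation S a"
  define e where "e = left_translation S \<one>"
  define \<chi> where "\<chi> = (\<lambda>X\<in>constructible S. if range z \<subseteq> X then 1 else 0 :: nat)"
  have zc: "z k \<in> carrier S" for k using z by blast
  have g_iff: "g s = Some t \<longleftrightarrow> s \<in> carrier S \<and> t \<in> carrier S \<and> a \<otimes> s = b \<otimes> t" for s t
    by (auto simp: g_def map_comp_Some_iff left_translation_eq_Some
        pinv_left_translation_eq_Some[OF b])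
  have g: "g \<in> left_inverse_hull S" and e: "e \<in> left_inverse_hull S"
    unfolding g_def e_def using a b
    by (auto intro!: left_inverse_hull.intros)
  have gz: "g (z k) = Some (z (transpose 0 1 k))" for k
    by (simp add: g_iff zc swap)
  have e_eq: "e t = (if t \<in> carrier S then Some t else None)" for t
    by (simp add: e_def left_translation_def)
  have \<chi>: "\<chi> \<in> Omega S"
    unfolding \<chi>_def using z dich by (rule limit_character)
  have \<chi>1: "\<chi> X = 1 \<longleftrightarrow> range z \<subseteq> X" and \<chi>0: "\<chi> X = 0 \<longleftrightarrow> \<not> range z \<subseteq> X"
    if "X \<in> constructible S" for X
    using that by (simp_all add: \<chi>_def)
  have dom_g: "\<chi> (dom g) = 1"
    unfolding \<chi>1[OF dom_in_constructible[OF g]] using gz by blast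
  have "\<chi> (dom e) = 1"
    unfolding \<chi>1[OF dom_in_constructible[OF e]] using zc e_eq by (auto intro: domI)
  with dom_g have pairs: "(g, \<chi>) \<in> germ_pairs S" "(e, \<chi>) \<in> germ_pairs S"
    using g e \<chi> by (simp_all add: germ_pairs_def)

  let ?F = "(\<lambda>j. (\<otimes>) (z j) ` carrier S) ` {0, 1}"
  have F: "finite ?F" "?F \<subseteq> constructible S"
    using zc principal_right_ideal_constructible by auto
  have "\<chi> Y = 0" if "Y \<in> ?F" for Y
  proof -
    \<comment> \<open>Any index other than 0 and 1 would do; one missing \<open>z k\<close> is
      enough for the limit character to vanish.\<close>
    have "z 2 \<notin> Y" using that sep[of 2 0] sep[of 2 1] by auto
    then have "\<not> range z \<subseteq> Y" by (meson rangeI subsetD)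
    moreover have "Y \<in> constructible S" using that F(2) by (rule rev_subsetD)
    ultimately show ?thesis using \<chi>0 by simp
  qed
  then have ext: "char_ext S \<chi> (dom g - \<Union>?F) = 1"
    using dom_g by (subst char_ext_diff[OF \<chi> dom_in_constructible[OF g] F]) simp
  have agree: "t \<in> dom e \<and> g t = e t" if t: "t \<in> dom g - \<Union>?F" for t
  proof -
    obtain u where u: "t \<in> carrier S" "u \<in> carrier S" "a \<otimes> t = b \<otimes> u"
      using t g_iff by blast
    obtain k s where ks: "s \<in> carrier S" "t = z k \<otimes> s"
      using lcm[OF u] by blast
    \<comment> \<open>Off the two removed ideals, \<open>t\<close> lies over an index fixed by the
      transposition.\<close>
    have "k \<noteq> 0" "k \<noteq> 1" using t ks by auto
    then have "a \<otimes> z k = b \<otimes> z k" using swap[of k] by simp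
    then have "a \<otimes> t = b \<otimes> t"
      using ks a b zc by (simp add: m_assoc[symmetric])
    then have "g t = Some t" using g_iff u(1) by blast
    then show ?thesis using u(1) e_eq by auto
  qed
  have bar: "dom g - \<Union>?F \<in> constructible_bar S"
    using dom_in_constructible[OF g] F by (rule diff_in_constructible_bar)
  have "(germ S g \<chi>, germ S e \<chi>) \<in> sim2 S"
    unfolding sim2_germ_iff[OF pairs]
    by (intro conjI refl bexI[OF _ bar] ext subsetI ballI) (use agree in blast)+
  then have "germ_quotient S (germ S g \<chi>) = germ_quotient S (germ S e \<chi>)"
    unfolding germ_quotient_def by (rule equiv_class_eq[OF equiv_sim2])
  moreover have "germ S g \<chi> \<in> carrier (groupoid_GP S)" "germ S e \<chi> \<in> carrier (groupoid_GP S)"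
    using pairs by (auto simp: carrier_groupoid_GP)
  ultimately have "germ S g \<chi> = germ S e \<chi>" using inj by (meson inj_onD)
  then obtain Y where Y: "Y \<in> constructible S" "\<chi> Y = 1" "\<forall>t\<in>Y. g t = e t"
    unfolding germ_eq_iff[OF pairs] germ_rel_iff by blast
  then have "g (z 0) = e (z 0)" using \<chi>1[OF Y(1)] by blast
  then have "z 0 = z 1" using gz[of 0] e_eq zc by simp
  moreover have "z 0 \<in> (\<otimes>) (z 0) ` carrier S" by (rule image_eqI[of _ _ \<one>]) (use zc in auto)
  ultimately show False using sep[of 1 0] by simp
qed

end

section \<open>The monoid, realised by normal forms of words\<close>

datatype letter = A | B | Z nat

instance letter :: countable
  by countable_datatype

text \<open>Left multiplication by a generator, with the relation oriented as B Z_k -> A Z_k', where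
  k' is the transposed index. One rewriting at the front suffices: no redex starts with
  \<open>A\<close> or \<open>Z\<close>.\<close>

fun push :: "letter \<Rightarrow> letter list \<Rightarrow> letter list" where
  "push B (Z k # r) = A # Z (transpose 0 1 k) # r"
| "push x v = x # v"

definition word_mult :: "letter list \<Rightarrow> letter list \<Rightarrow> letter list" where
  "word_mult u v = foldr push u v"

text \<open>The elements of the monoid are the words without a factor \<open>B, Z k\<close>.\<close>

definition normal_words :: "letter list set" where
  "normal_words = range (\<lambda>u. word_mult u [])"

lemma word_mult_Nil [simp]: "word_mult [] v = v"
  and word_mult_Cons [simp]: "word_mult (x # u) v = push x (word_mult u v)"
  by (simp_all add: word_mult_def)

lemma push_Z [simp]: "push (Z k) v = Z k # v" and push_A [simp]: "push A v = A # v"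
  by (cases v; simp)+

lemma push_B: "push B v = (case v of Z k # r \<Rightarrow> A # Z (transpose 0 1 k) # r | _ \<Rightarrow> B # v)"
  by (cases v rule: list.exhaust; simp split: letter.split)

text \<open>Only a rewriting at the front needs care. A leading \<open>Z k\<close> stays in front
  under multiplication on the right, so the rewriting may come before or after it. Normality of the
  words does not enter.\<close>

lemma word_mult_push: "word_mult (push x v) w = push x (word_mult v w)"
  by (cases "(x, v)" rule: push.cases) auto

lemma word_mult_assoc: "word_mult (word_mult u v) w = word_mult u (word_mult v w)"
  by (induction u) (simp_all add: word_mult_push)

lemma word_mult_append: "word_mult (u @ v) w = word_mult u (word_mult v w)"
  by (induction u) simp_all

text \<open>For \<open>B\<close>, the first letter of the result tells whether rewriting took place,
  and the transposition undoes it.\<close>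

lemma inj_push: "inj (push x)"
  by (cases x) (auto simp: inj_def push_B split: list.splits letter.splits
      dest: injD[OF inj_transpose])

lemma inj_word_mult: "inj (word_mult u)"
proof (induction u)
  case (Cons x u)
  have "word_mult (x # u) = push x \<circ> word_mult u" by (simp add: fun_eq_iff)
  then show ?case using inj_compose[OF inj_push Cons] by metis
qed (simp add: inj_def)

text \<open>The first letter of \<open>push x p\<close> is \<open>x\<close> unless
  \<open>x = B\<close> and a rewriting occurs, so distinct letters have common right multiples only
  through the defining relation.\<close>

lemma push_eq_push:
  assumes "push x p = push y q" "x \<noteq> y"
  obtains k r where "{x, y} = {A, B}" "p = Z k # r" "q = Z (transpose 0 1 k) # r"
proof -
  have "\<exists>k r. {x, y} = {A, B} \<and> p = Z k # r \<and> q = Z (transpose 0 1 k) # r"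
    using assms
    by (cases x; cases y)
      (auto simp: push_B insert_commute split: list.splits letter.splits
        intro: transpose_involutory[symmetric])
  then show thesis using that by blast
qed

lemma word_mult_in_normal_words: "v \<in> normal_words \<Longrightarrow> word_mult u v \<in> normal_words"
  by (auto simp: normal_words_def word_mult_append[symmetric])

lemma word_mult_Nil_right: "u \<in> normal_words \<Longrightarrow> word_mult u [] = u"
  by (auto simp: normal_words_def word_mult_assoc)

lemma normal_words_letters: "[] \<in> normal_words" "[x] \<in> normal_words"
  by (force simp: normal_words_def intro: range_eqI[of _ _ "[]"] range_eqI[of _ _ "[x]"])+

text \<open>Words form a countable type, so \<open>to_nat\<close> transports the monoid to the type
  \<open>nat\<close> that the theorem asks for.\<close>

definition word_monoid :: "nat monoid" where
  "word_monoid = \<lparr>carrier = to_nat ` normal_words,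
     mult = (\<lambda>m n. to_nat (word_mult (from_nat m) (from_nat n))),
     one = to_nat ([] :: letter list)\<rparr>"

lemma word_monoid_simps [simp]:
  "carrier word_monoid = to_nat ` normal_words"
  "to_nat u \<otimes>\<^bsub>word_monoid\<^esub> to_nat v = to_nat (word_mult u v)"
  "\<one>\<^bsub>word_monoid\<^esub> = to_nat ([] :: letter list)"
  by (simp_all add: word_monoid_def)

lemma left_cancellative_word_monoid: "left_cancellative_monoid word_monoid"
proof
qed (auto simp: word_mult_assoc word_mult_in_normal_words word_mult_Nil_right normal_words_letters
    dest: injD[OF inj_word_mult])

section \<open>The dichotomy for constructible ideals\<close>

text \<open>Quantifying over all words in front of \<open>Z k\<close> makes the dichotomy stable under preimages.\<close>

definition Z_dichotomous :: "letter list set \<Rightarrow> bool" where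
  "Z_dichotomous X \<longleftrightarrow> (\<forall>w. finite {k. word_mult w [Z k] \<in> X} \<or> (\<forall>k. word_mult w [Z k] \<in> X))"

lemma Z_dichotomous_preimage: "Z_dichotomous X \<Longrightarrow> Z_dichotomous {v. word_mult u v \<in> X}"
  by (simp add: Z_dichotomous_def word_mult_append[symmetric])

text \<open>Compare \<open>x\<close> with the first letter of \<open>w\<close>. Equal letters
  cancel; distinct ones can meet only through the defining relation, which changes just the index of
  a leading \<open>Z\<close> and so leads back to the dichotomy for \<open>X\<close>.\<close>

lemma Z_dichotomous_image_push:
  assumes "Z_dichotomous X"
  shows "Z_dichotomous (push x ` X)"
  unfolding Z_dichotomous_def
proof
  fix w
  let ?D = "\<lambda>P. finite {k. P k} \<or> (\<forall>k. P k)"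
  have X: "?D (\<lambda>k. word_mult w [Z k] \<in> X)" for w
    using assms by (simp add: Z_dichotomous_def)
  show "?D (\<lambda>k. word_mult w [Z k] \<in> push x ` X)"
  proof (cases w)
    case Nil
    \<comment> \<open>A one-letter word \<open>[Z k]\<close> arises only by pushing
      \<open>Z k\<close> itself.\<close>
    have "{k. [Z k] \<in> push x ` X} \<subseteq> {k. x = Z k}"
      by (cases x) (auto simp: push_B split: list.splits letter.splits)
    moreover have "finite {k. x = Z k}" by (cases x) simp_all
    ultimately have "finite {k. [Z k] \<in> push x ` X}" by (rule finite_subset)
    then show ?thesis using Nil by simp
  next
    case (Cons y w')
    show ?thesis
    proof (cases "y = x")
      case True
      then show ?thesis using X[of w'] Cons by (simp add: inj_image_mem_iff[OF inj_push])
    next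
      case False
      show ?thesis
      proof (cases "{y, x} = {A, B}")
        case AB: True
        have push_iff: "push y p \<in> push x ` X \<longleftrightarrow>
            (\<exists>i r. p = Z i # r \<and> Z (transpose 0 1 i) # r \<in> X)" for p
        proof
          assume "push y p \<in> push x ` X"
          then show "\<exists>i r. p = Z i # r \<and> Z (transpose 0 1 i) # r \<in> X"
            using False by (auto elim!: push_eq_push)
        next
          assume "\<exists>i r. p = Z i # r \<and> Z (transpose 0 1 i) # r \<in> X"
          then obtain i r where ir: "p = Z i # r" "Z (transpose 0 1 i) # r \<in> X" by blast
          then have "push y p = push x (Z (transpose 0 1 i) # r)"
            using AB False by (auto simp: doubleton_eq_iff)
          then show "push y p \<in> push x ` X" using ir by blast
        qed
        show ?thesis
        proof (cases w')
          case Nil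
          \<comment> \<open>Here the varying letter itself takes part in the relation; permuting the
            indices preserves the dichotomy.\<close>
          have "?D (\<lambda>k. [Z k] \<in> X)" using X[of "[]"] by simp
          then have "?D (\<lambda>k. [Z (transpose 0 1 k)] \<in> X)"
            using finite_vimageI[OF _ inj_transpose, of "{k. [Z k] \<in> X}" 0 1] by (auto simp: vimage_def)
          then show ?thesis using Cons Nil by (simp add: push_iff)
        next
          case (Cons v w'')
          show ?thesis
          proof (cases v)
            \<comment> \<open>The relation changes the fixed index \<open>j\<close> only, so the
              dichotomy for \<open>X\<close> is used with another prefix.\<close>
            case (Z j)
            then show ?thesis
              using X[of "Z (transpose 0 1 j) # w''"] \<open>w = y # w'\<close> Cons by (simp add: push_iff)
          next
            \<comment> \<open>A word built on a leading \<open>A\<close> or \<open>B\<close> never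
              starts with a \<open>Z\<close>, so no \<open>k\<close> qualifies.\<close>
            case A
            then have "word_mult w' [Z k] \<noteq> Z i # r" for k i r using Cons by simp
            then show ?thesis using \<open>w = y # w'\<close> by (simp add: push_iff)
          next
            case B
            then have "word_mult w' [Z k] \<noteq> Z i # r" for k i r
              using Cons by (auto simp: push_B split: list.splits letter.splits)
            then show ?thesis using \<open>w = y # w'\<close> by (simp add: push_iff)
          qed
        qed
      next
        case nAB: False
        have "push y p \<notin> push x ` X" for p
          using False nAB by (auto elim!: push_eq_push)
        then show ?thesis using Cons by simp
      qed
    qed
  qed
qed

lemma Z_dichotomous_image: "Z_dichotomous X \<Longrightarrow> Z_dichotomous (word_mult u ` X)"
proof (induction u)
  case (Cons x u)
  have "word_mult (x # u) ` X = push x ` word_mult u ` X" by (simp add: image_image)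
  then show ?case using Cons Z_dichotomous_image_push by metis
qed simp

lemma Z_dichotomous_constructible:
  assumes "X \<in> constructible word_monoid"
  shows "Z_dichotomous (to_nat -` X)"
proof -
  interpret left_cancellative_monoid word_monoid by (rule left_cancellative_word_monoid)
  \<comment> \<open>All test words of the dichotomy lie in the carrier, so restricting a preimage to
    the carrier does not affect it.\<close>
  have normal: "word_mult w [Z k] \<in> normal_words" for w k
    by (intro word_mult_in_normal_words normal_words_letters)
  from assms show ?thesis
  proof (induction rule: constructible_induct)
    case carrier
    then show ?case using normal by (simp add: Z_dichotomous_def)
  next
    case (preimage s X)
    then obtain u :: "letter list" where u: "s = to_nat u" "u \<in> normal_words" by auto
    have "Z_dichotomous {v. word_mult u v \<in> to_nat -` X}"
      using preimage(3) by (rule Z_dichotomous_preimage)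
    then show ?case using normal u by (simp add: Z_dichotomous_def inj_image_mem_iff)
  next
    case (image s X)
    then obtain u :: "letter list" where u: "s = to_nat u" "u \<in> normal_words" by auto
    have "to_nat -` ((\<otimes>\<^bsub>word_monoid\<^esub>) s ` X) = word_mult u ` (to_nat -` X)"
    proof (intro equalityI subsetI)
      fix v :: "letter list" assume "v \<in> to_nat -` ((\<otimes>\<^bsub>word_monoid\<^esub>) s ` X)"
      then obtain m where m: "m \<in> X" "to_nat v = s \<otimes>\<^bsub>word_monoid\<^esub> m" by auto
      moreover obtain v' :: "letter list" where "m = to_nat v'" using image(2) m(1) by auto
      ultimately show "v \<in> word_mult u ` (to_nat -` X)" using u(1) by auto
    next
      fix v assume "v \<in> word_mult u ` (to_nat -` X)"
      then obtain v' where "v = word_mult u v'" "to_nat v' \<in> X" by blast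
      then show "v \<in> to_nat -` ((\<otimes>\<^bsub>word_monoid\<^esub>) s ` X)"
        using u(1) by (auto intro: image_eqI[of _ _ "to_nat v'"])
    qed
    then show ?case using image(3) by (simp add: Z_dichotomous_image)
  qed
qed

theorem mainTheorem4:
  "\<exists>S :: nat monoid. left_cancellative_monoid S \<and>
     \<not> inj_on (germ_quotient S) (carrier (groupoid_GP S))"
proof (intro exI conjI)
  show "left_cancellative_monoid word_monoid" by (rule left_cancellative_word_monoid)
  then interpret left_cancellative_monoid word_monoid .
  let ?z = "\<lambda>k. to_nat [Z k]"
  show "\<not> inj_on (germ_quotient word_monoid) (carrier (groupoid_GP word_monoid))"
  proof (rule not_inj_on_germ_quotient[of "to_nat [A]" "to_nat [B]" ?z])
    show "\<exists>k. s \<in> (\<otimes>\<^bsub>word_monoid\<^esub>) (?z k) ` carrier word_monoid"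
      if st: "s \<in> carrier word_monoid" "t \<in> carrier word_monoid"
        and eq: "to_nat [A] \<otimes>\<^bsub>word_monoid\<^esub> s = to_nat [B] \<otimes>\<^bsub>word_monoid\<^esub> t" for s t
    proof -
      obtain u v :: "letter list" where u: "s = to_nat u" "u \<in> normal_words" and v: "t = to_nat v"
        using st by auto
      then have "push A u = push B v" using eq by simp
      then obtain k r where r: "u = Z k # r" by (rule push_eq_push) simp
      \<comment> \<open>The tail of a normal word is normal, because pushing \<open>Z k\<close>
        never rewrites.\<close>
      have "r = word_mult r []"
        using word_mult_Nil_right[OF u(2)] r by simp
      then have "r \<in> normal_words" by (auto simp: normal_words_def)
      then show ?thesis using u r by (auto intro!: exI[of _ k] image_eqI[of _ _ "to_nat r"])
    qed
    show "finite {k. ?z k \<in> X} \<or> range ?z \<subseteq> X" if "X \<in> constructible word_monoid" for X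
      using Z_dichotomous_constructible[OF that]
      unfolding Z_dichotomous_def by (auto dest: spec[of _ "[]"])
  qed (auto simp: normal_words_letters)
qed

end
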